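(* Assume $\tau,\tau_X,\tau_Y<\infty$. Then: 1. In Case S1, $2\tau-\tau_X-\tau_Y=0$ if and only if $X_{(i)}\overset{d}{=}Y_{(i)}$ for $i\in\{1,\dots,p\}$. 2. In Case S2, $2\tau-\tau_X-\tau_Y=0$ if and only if $\mu_X=\mu_Y$ and $\mathrm{tr}\,\Sigma_X=\mathrm{tr}\,\Sigma_Y$.
   Context: $X=(X_{(1)},\dots,X_{(p)})$ and $Y=(Y_{(1)},\dots,Y_{(p)})$ are independent random vectors in $\mathbb R^{\tilde p}$, $\tilde p=\sum_{i=1}^p d_i$, with groups $X_{(i)},Y_{(i)}\in\mathbb R^{d_i}$; $(X',Y')$ is an independent copy of $(X,Y)$. $\mu_X,\mu_Y$ and $\Sigma_X,\Sigma_Y$ denote the mean vectors and covariance matrices of $X,Y$. The distance is $K(x,x')=\sqrt{\sum_{i=1}^p\rho_i(x_{(i)},x'_{(i)})}$. Case S1: each $\rho_i$ is a metric of strong negative type on $\mathbb R^{d_i}$. Case S2: $\rho_i(x_{(i)},x'_{(i)})=\|x_{(i)}-x'_{(i)}\|^2$ for each $i$ (so $K$ is the Euclidean distance). A metric space $(\mathcal X,d)$ has negative type if for all $n\ge1$, $x_1,\dots,x_n\in\mathcal X$ and $\alpha_1,\dots,\alpha_n\in\mathbb R$ with $\sum_{i}\alpha_i=0$ one has $\sum_{i,j=1}^n\alpha_i\alpha_jd(x_i,x_j)\le0$; it has strong negative type if moreover (for distinct points $x_1,\dots,x_n$) equality holds only when $\alpha_i=0$ for all $i$. $\tau_X^2=E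 K(X,X')^2$, $\tau_Y^2=E K(Y,Y')^2$, $\tau^2=E K(X,Y)^2$, with $\tau_X,\tau_Y,\tau$ the nonnegative square roots.
   Formalization: Strong negative type is taken in Lyons' sense: equality for P−Q, with P, Q probability measures of finite first moment, only if P=Q. With equality excluded only for finitely many distinct points, item 1 is false. Each ρ_i in Case S1 is assumed Borel measurable. *)

theory Defs
  imports "HOL-Probability.Probability"
begin

text \<open>
  A point of \<open>\<real>\<^sup>k\<close> is an extensional function on \<open>{1..k}\<close>.  A point \<open>x\<close> of the grouped space
  \<open>\<real>\<^bsup>d 1 + \<dots> + d p\<^esup>\<close> is the tuple of its groups \<open>x 1, \<dots>, x p\<close> with \<open>x i \<in> \<real>\<^bsup>d i\<^esup>\<close>.
  Both spaces carry the Borel sigma-algebra of their Euclidean topology.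
\<close>

definition Rn :: "nat \<Rightarrow> (nat \<Rightarrow> real) measure" where
  "Rn k = PiM {1..k} (\<lambda>_. borel)"

definition grouped :: "nat \<Rightarrow> (nat \<Rightarrow> nat) \<Rightarrow> (nat \<Rightarrow> nat \<Rightarrow> real) measure" where
  "grouped p d = PiM {1..p} (\<lambda>i. Rn (d i))"

text \<open>
  \<^const>\<open>Metric_space\<close> also asks for symmetry and nonnegativity off the carrier \<open>S\<close>; this is
  no restriction, since a metric on \<open>S\<close> may be extended by \<open>0\<close>.
\<close>

definition negative_type :: "'a set \<Rightarrow> ('a \<Rightarrow> 'a \<Rightarrow> real) \<Rightarrow> bool" where
  "negative_type S \<delta> \<longleftrightarrow> Metric_space S \<delta> \<and>
     (\<forall>n\<ge>1. \<forall>(x :: nat \<Rightarrow> 'a) (\<alpha> :: nat \<Rightarrow> real).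
        x ` {1..n} \<subseteq> S \<longrightarrow> (\<Sum>i=1..n. \<alpha> i) = 0 \<longrightarrow>
        (\<Sum>i=1..n. \<Sum>j=1..n. \<alpha> i * \<alpha> j * \<delta> (x i) (x j)) \<le> 0)"

definition finite_first_moment :: "('a \<Rightarrow> 'a \<Rightarrow> real) \<Rightarrow> 'a measure \<Rightarrow> bool" where
  "finite_first_moment \<delta> P \<longleftrightarrow> (\<exists>c\<in>space P. integrable P (\<delta> c))"

text \<open>
  Strong negative type in the sense of Lyons (\<^emph>\<open>Distance covariance in metric spaces\<close>, 2013):
  the case of equality concerns the signed measures \<open>P - Q\<close> for arbitrary probability
  measures with finite first moment.  If equality is only excluded for finitely many distinct
  points (``strict'' negative type, which is implied by the lemma below), then the energy
  distance need not separate probability measures, even for Borel measurable metrics on \<open>\<real>\<close>.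
\<close>

definition strong_negative_type :: "'a measure \<Rightarrow> ('a \<Rightarrow> 'a \<Rightarrow> real) \<Rightarrow> bool" where
  "strong_negative_type N \<delta> \<longleftrightarrow> negative_type (space N) \<delta> \<and>
     (\<forall>P Q. prob_space P \<longrightarrow> sets P = sets N \<longrightarrow> finite_first_moment \<delta> P \<longrightarrow>
            prob_space Q \<longrightarrow> sets Q = sets N \<longrightarrow> finite_first_moment \<delta> Q \<longrightarrow>
            2 * (\<integral>x. (\<integral>y. \<delta> x y \<partial>Q) \<partial>P)
              - (\<integral>x. (\<integral>y. \<delta> x y \<partial>P) \<partial>P) - (\<integral>x. (\<integral>y. \<delta> x y \<partial>Q) \<partial>Q) = 0 \<longrightarrow> P = Q)"

lemma strong_negative_type_imp_strict:
  fixes x :: "nat \<Rightarrow> 'a" and \<alpha> :: "nat \<Rightarrow> real"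
  assumes strong: "strong_negative_type N \<delta>"
    and meas: "(\<lambda>(x, y). \<delta> x y) \<in> borel_measurable (N \<Otimes>\<^sub>M N)"
    and single: "\<And>a. a \<in> space N \<Longrightarrow> {a} \<in> sets N"
    and x: "x ` {1..n} \<subseteq> space N" and inj: "inj_on x {1..n}"
    and sum0: "(\<Sum>i=1..n. \<alpha> i) = 0"
    and eq: "(\<Sum>i=1..n. \<Sum>j=1..n. \<alpha> i * \<alpha> j * \<delta> (x i) (x j)) = 0"
    and i: "i \<in> {1..n}"
  shows "\<alpha> i = 0"
proof (rule ccontr)
  assume ai: "\<alpha> i \<noteq> 0"
  define c where "c = (\<Sum>i=1..n. max (\<alpha> i) 0)"
  have c': "c = (\<Sum>i=1..n. max (- \<alpha> i) 0)"
  proof -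
    have "c - (\<Sum>i=1..n. max (- \<alpha> i) 0) = (\<Sum>i=1..n. \<alpha> i)"
      unfolding c_def sum_subtractf[symmetric] by (intro sum.cong) (auto simp: max_def)
    with sum0 show ?thesis by simp
  qed
  have cpos: "c > 0"
  proof (cases "\<alpha> i > 0")
    case True
    then show ?thesis unfolding c_def using i by (intro sum_pos2[of _ i]) auto
  next
    case False
    with ai show ?thesis unfolding c' using i by (intro sum_pos2[of _ i]) auto
  qed
  define z where "z = (\<lambda>k. if k \<in> {1..n} then x k else x i)"
  have z: "z k \<in> space N" for k using x i by (auto simp: z_def)
  have zm [measurable]: "z \<in> measurable (measure_pmf p) N" for p using z by auto
  define wt where "wt = (\<lambda>(s :: real) k. if k \<in> {1..n} then max (s * \<alpha> k) 0 / c else 0)"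
  define D where "D = (\<lambda>s. distr (measure_pmf (embed_pmf (wt s))) N z)"
  have pmf_wt: "pmf (embed_pmf (wt s)) k = wt s k" if s: "s = 1 \<or> s = -1" for s k
  proof (rule pmf_embed_pmf)
    show "0 \<le> wt s k" for k using cpos by (auto simp: wt_def)
    have "(\<integral>\<^sup>+k. ennreal (wt s k) \<partial>count_space UNIV)
        = (\<integral>\<^sup>+k. ennreal (wt s k) \<partial>count_space {1..n})"
      by (rule nn_integral_count_space_eq) (auto simp: wt_def)
    also have "\<dots> = (\<Sum>k=1..n. ennreal (wt s k))"
      by (simp add: nn_integral_count_space_finite)
    also have "\<dots> = ennreal (\<Sum>k=1..n. wt s k)"
      using cpos by (intro sum_ennreal) (auto simp: wt_def)
    also have "(\<Sum>k=1..n. wt s k) = (\<Sum>k=1..n. max (s * \<alpha> k) 0) / c"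
      by (auto simp: wt_def sum_divide_distrib intro!: sum.cong)
    also have "\<dots> = 1" using s cpos c_def c' by auto
    finally show "(\<integral>\<^sup>+k. ennreal (wt s k) \<partial>count_space UNIV) = 1" by simp
  qed
  have supp: "set_pmf (embed_pmf (wt s)) \<subseteq> {1..n}" if "s = 1 \<or> s = -1" for s
    using pmf_wt[OF that] by (auto simp: set_pmf_eq wt_def split: if_splits)
  have int: "(\<integral>a. f a \<partial>D s) = (\<Sum>k=1..n. wt s k * f (x k))"
    if s: "s = 1 \<or> s = -1" and f: "f \<in> borel_measurable N" for s and f :: "'a \<Rightarrow> real"
  proof -
    have "(\<integral>a. f a \<partial>D s) = (\<integral>k. f (z k) \<partial>measure_pmf (embed_pmf (wt s)))"
      unfolding D_def using f by (intro integral_distr) (auto intro: z)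
    also have "\<dots> = (\<Sum>k=1..n. f (z k) * pmf (embed_pmf (wt s)) k)"
      using supp[OF s] by (intro integral_measure_pmf_real) auto
    finally show ?thesis by (simp add: pmf_wt[OF s] z_def mult.commute)
  qed
  have m1: "\<delta> a \<in> borel_measurable N" if "a \<in> space N" for a
    using measurable_compose[OF measurable_Pair1'[OF that] meas] by simp
  have pr: "prob_space (D s)" for s
    unfolding D_def by (intro prob_space.prob_space_distr measure_pmf.prob_space_axioms zm)
  have spD: "space (D s) = space N" and seD: "sets (D s) = sets N" for s by (auto simp: D_def)
  have fm: "finite_first_moment \<delta> (D s)" if s: "s = 1 \<or> s = -1" for s
    unfolding finite_first_moment_def
  proof
    show "z i \<in> space (D s)" using z spD by simp
    have "finite (set_pmf (embed_pmf (wt s)))" using supp[OF s] finite_subset by blast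
    then show "integrable (D s) (\<delta> (z i))"
      unfolding D_def using m1[OF z] by (subst integrable_distr_eq)
        (auto intro: integrable_measure_pmf_finite z)
  qed
  have dbl: "(\<integral>a. (\<integral>b. \<delta> a b \<partial>D t) \<partial>D s)
      = (\<Sum>k=1..n. \<Sum>l=1..n. wt s k * wt t l * \<delta> (x k) (x l))"
    if s: "s = 1 \<or> s = -1" and t: "t = 1 \<or> t = -1" for s t
  proof -
    interpret T: prob_space "D t" by (rule pr)
    have mi: "(\<lambda>a. \<integral>b. \<delta> a b \<partial>D t) \<in> borel_measurable N"
    proof (rule T.borel_measurable_lebesgue_integral)
      have "sets (N \<Otimes>\<^sub>M D t) = sets (N \<Otimes>\<^sub>M N)"
        by (rule sets_pair_measure_cong[OF refl seD])
      then show "(\<lambda>(a, b). \<delta> a b) \<in> borel_measurable (N \<Otimes>\<^sub>M D t)"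
        using meas measurable_cong_sets by blast
    qed
    have "(\<integral>a. (\<integral>b. \<delta> a b \<partial>D t) \<partial>D s) = (\<Sum>k=1..n. wt s k * (\<integral>b. \<delta> (x k) b \<partial>D t))"
      by (rule int[OF s mi])
    also have "\<dots> = (\<Sum>k=1..n. wt s k * (\<Sum>l=1..n. wt t l * \<delta> (x k) (x l)))"
      using x by (intro sum.cong refl arg_cong2[where f = "(*)"] int[OF t] m1) auto
    finally show ?thesis by (simp add: sum_distrib_left mult.assoc)
  qed
  have wt_diff: "wt 1 k - wt (-1) k = \<alpha> k / c" if "k \<in> {1..n}" for k
    using that cpos by (auto simp: wt_def max_def field_simps)
  have comm: "\<delta> a b = \<delta> b a" for a b
    using strong unfolding strong_negative_type_def negative_type_def
    by (metis Metric_space.commute)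
  have swap: "(\<Sum>k=1..n. \<Sum>l=1..n. wt (-1) k * wt 1 l * \<delta> (x k) (x l))
      = (\<Sum>k=1..n. \<Sum>l=1..n. wt 1 k * wt (-1) l * \<delta> (x k) (x l))"
    by (subst sum.swap, intro sum.cong refl)
      (metis comm mult.commute)
  have "2 * (\<integral>a. (\<integral>b. \<delta> a b \<partial>D (-1)) \<partial>D 1)
      - (\<integral>a. (\<integral>b. \<delta> a b \<partial>D 1) \<partial>D 1) - (\<integral>a. (\<integral>b. \<delta> a b \<partial>D (-1)) \<partial>D (-1))
      = - (\<Sum>k=1..n. \<Sum>l=1..n. (wt 1 k - wt (-1) k) * (wt 1 l - wt (-1) l) * \<delta> (x k) (x l))"
    using swap by (simp add: dbl algebra_simps sum.distrib sum_subtractf)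
  also have "(\<Sum>k=1..n. \<Sum>l=1..n. (wt 1 k - wt (-1) k) * (wt 1 l - wt (-1) l) * \<delta> (x k) (x l))
      = (\<Sum>k=1..n. \<Sum>l=1..n. \<alpha> k * \<alpha> l * \<delta> (x k) (x l)) / (c * c)"
    by (simp add: wt_diff sum_divide_distrib)
  finally have "2 * (\<integral>a. (\<integral>b. \<delta> a b \<partial>D (-1)) \<partial>D 1)
      - (\<integral>a. (\<integral>b. \<delta> a b \<partial>D 1) \<partial>D 1) - (\<integral>a. (\<integral>b. \<delta> a b \<partial>D (-1)) \<partial>D (-1)) = 0"
    using eq by simp
  then have DD: "D 1 = D (-1)"
    using strong pr seD fm unfolding strong_negative_type_def by blast
  have xi: "x i \<in> space N" using x i by auto
  have "(\<integral>a. indicator {x i} a \<partial>D s) = wt s i" if s: "s = 1 \<or> s = -1" for s :: real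
  proof -
    have "(\<integral>a. indicator {x i} a \<partial>D s) = (\<Sum>k=1..n. wt s k * indicator {x i} (x k))"
      using single[OF xi] by (intro int[OF s]) auto
    also have "\<dots> = (\<Sum>k=1..n. if k = i then wt s k else 0)"
      using i by (intro sum.cong) (simp_all add: inj_on_eq_iff[OF inj] indicator_def)
    finally show ?thesis using i by simp
  qed
  then have "wt 1 i = wt (-1) i" using DD by metis
  with wt_diff[OF i] ai cpos show False by simp
qed

definition K_dist ::
    "nat \<Rightarrow> (nat \<Rightarrow> (nat \<Rightarrow> real) \<Rightarrow> (nat \<Rightarrow> real) \<Rightarrow> real) \<Rightarrow>
     (nat \<Rightarrow> nat \<Rightarrow> real) \<Rightarrow> (nat \<Rightarrow> nat \<Rightarrow> real) \<Rightarrow> real" where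
  "K_dist p \<rho> x x' = sqrt (\<Sum>i=1..p. \<rho> i (x i) (x' i))"

definition rms_dist :: "'w measure \<Rightarrow> ('a \<Rightarrow> 'a \<Rightarrow> real) \<Rightarrow> ('w \<Rightarrow> 'a) \<Rightarrow> ('w \<Rightarrow> 'a) \<Rightarrow> real" where
  "rms_dist M K U V = sqrt (\<integral>\<omega>. (K (U \<omega>) (V \<omega>))\<^sup>2 \<partial>M)"

definition mean_vec ::
    "'w measure \<Rightarrow> nat \<Rightarrow> (nat \<Rightarrow> nat) \<Rightarrow> ('w \<Rightarrow> nat \<Rightarrow> nat \<Rightarrow> real) \<Rightarrow> nat \<Rightarrow> nat \<Rightarrow> real" where
  "mean_vec M p d X = (\<lambda>i\<in>{1..p}. \<lambda>j\<in>{1..d i}. \<integral>\<omega>. X \<omega> i j \<partial>M)"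

text \<open>Rows and columns of the covariance matrix are indexed by the pairs \<open>(i, j)\<close>,
  \<open>j \<in> {1..d i}\<close>, of a group and a coordinate within it.\<close>

definition coords :: "nat \<Rightarrow> (nat \<Rightarrow> nat) \<Rightarrow> (nat \<times> nat) set" where
  "coords p d = (SIGMA i:{1..p}. {1..d i})"

definition cov_mat ::
    "'w measure \<Rightarrow> nat \<Rightarrow> (nat \<Rightarrow> nat) \<Rightarrow> ('w \<Rightarrow> nat \<Rightarrow> nat \<Rightarrow> real) \<Rightarrow>
     nat \<times> nat \<Rightarrow> nat \<times> nat \<Rightarrow> real" where
  "cov_mat M p d X = (\<lambda>(i, j) (k, l).
     \<integral>\<omega>. (X \<omega> i j - mean_vec M p d X i j) * (X \<omega> k l - mean_vec M p d X k l) \<partial>M)"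

definition trace_on :: "'i set \<Rightarrow> ('i \<Rightarrow> 'i \<Rightarrow> real) \<Rightarrow> real" where
  "trace_on I A = (\<Sum>a\<in>I. A a a)"

end

theory Submission
  imports Defs
begin

text \<open>
  The squares of \<open>\<tau>\<close>, \<open>\<tau>\<^sub>X\<close>, \<open>\<tau>\<^sub>Y\<close> are sums over the groups of expectations of \<open>\<rho> i\<close>, and
  \<open>2\<tau>\<^sup>2 - \<tau>\<^sub>X\<^sup>2 - \<tau>\<^sub>Y\<^sup>2\<close> is a sum of energy distances, hence nonnegative.  As
  \<open>(\<tau>\<^sub>X + \<tau>\<^sub>Y)\<^sup>2 \<le> 2(\<tau>\<^sub>X\<^sup>2 + \<tau>\<^sub>Y\<^sup>2)\<close> with equality only for \<open>\<tau>\<^sub>X = \<tau>\<^sub>Y\<close>, the identity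
  \<open>2\<tau> = \<tau>\<^sub>X + \<tau>\<^sub>Y\<close> says that every energy distance vanishes and that \<open>\<tau>\<^sub>X = \<tau>\<^sub>Y\<close>.  In Case S1
  the first condition is equality of the group marginals, which implies the second one; in
  Case S2 the energy distance of a coordinate is twice the squared difference of the means, and
  \<open>\<tau>\<^sub>X\<^sup>2\<close>, \<open>\<tau>\<^sub>Y\<^sup>2\<close> are twice the traces of the covariance matrices.
\<close>

text \<open>Squaring \<open>2 * sqrt c = sqrt a + sqrt b\<close> gives
  \<open>4 * c = a + b + 2 * sqrt a * sqrt b\<close>, so the square of
  \<open>sqrt a - sqrt b\<close> equals \<open>2 * (a + b) - 4 * c\<close>. The third hypothesis
  makes this nonpositive, which forces \<open>a = b\<close>.\<close>

lemma double_sqrt_eq_sum_sqrt_iff: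
  fixes a b c :: real
  assumes "0 \<le> a" "0 \<le> b" "a + b \<le> 2 * c"
  shows "2 * sqrt c - sqrt a - sqrt b = 0 \<longleftrightarrow> a + b = 2 * c \<and> a = b"
proof
  assume eq: "2 * sqrt c - sqrt a - sqrt b = 0"
  have sq: "(sqrt a)\<^sup>2 = a" "(sqrt b)\<^sup>2 = b" "(sqrt c)\<^sup>2 = c" using assms by auto
  have "(2 * sqrt c)\<^sup>2 = (sqrt a + sqrt b)\<^sup>2" using eq by (simp add: algebra_simps)
  then have c4: "4 * c = a + b + 2 * (sqrt a * sqrt b)"
    using sq by (simp add: power2_sum power_mult_distrib)
  have "(sqrt a - sqrt b)\<^sup>2 = a + b - 2 * (sqrt a * sqrt b)"
    using sq by (simp add: power2_diff)
  then have "(sqrt a - sqrt b)\<^sup>2 \<le> 0" using c4 assms by simp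
  then have "sqrt a = sqrt b" by simp
  then show "a + b = 2 * c \<and> a = b" using c4 sq by (simp add: power2_eq_square)
qed auto

text \<open>Both sides are determined by their values on rectangles, and the preimage of a rectangle
  is a cylinder over two distinct coordinates. For \<open>i = j\<close> the pair would sit on the
  diagonal and the claim would fail in general.\<close>

lemma (in product_prob_space) distr_PiM_pair_component:
  assumes "i \<in> I" "j \<in> I" "i \<noteq> j"
  shows "distr (PiM I M) (M i \<Otimes>\<^sub>M M j) (\<lambda>\<omega>. (\<omega> i, \<omega> j)) = M i \<Otimes>\<^sub>M M j"
proof (rule sym, rule pair_measure_eqI)
  show "sigma_finite_measure (M i)" "sigma_finite_measure (M j)" by unfold_locales
  fix A B assume AB: "A \<in> sets (M i)" "B \<in> sets (M j)"
  \<comment> \<open>The two sides of the rectangle form one family indexed by coordinates, which is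
    the shape of a cylinder set; \<open>i \<noteq> j\<close> makes \<open>E j\<close> equal to
    \<open>B\<close>.\<close>
  define E where "E = (\<lambda>k. if k = i then A else B)"
  have m: "(\<lambda>\<omega>. (\<omega> i, \<omega> j)) \<in> measurable (PiM I M) (M i \<Otimes>\<^sub>M M j)"
    using assms by measurable
  have "emeasure (distr (PiM I M) (M i \<Otimes>\<^sub>M M j) (\<lambda>\<omega>. (\<omega> i, \<omega> j))) (A \<times> B)
      = emeasure (PiM I M) ((\<lambda>\<omega>. (\<omega> i, \<omega> j)) -` (A \<times> B) \<inter> space (PiM I M))"
    using AB by (intro emeasure_distr m) auto
  also have "(\<lambda>\<omega>. (\<omega> i, \<omega> j)) -` (A \<times> B) \<inter> space (PiM I M)
      = {\<omega> \<in> space (PiM I M). \<forall>k\<in>{i, j}. \<omega> k \<in> E k}"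
    using assms by (auto simp: E_def)
  also have "emeasure (PiM I M) \<dots> = (\<Prod>k\<in>{i, j}. emeasure (M k) (E k))"
    using AB assms by (intro emeasure_PiM_Collect) (auto simp: E_def)
  also have "\<dots> = emeasure (M i) A * emeasure (M j) B"
    using assms by (simp add: E_def)
  finally show "emeasure (M i) A * emeasure (M j) B
      = emeasure (distr (PiM I M) (M i \<Otimes>\<^sub>M M j) (\<lambda>\<omega>. (\<omega> i, \<omega> j))) (A \<times> B)" ..
qed simp

text \<open>Evaluates sums over a sample whose first half follows one law and whose second half
  follows another. Nested, it evaluates the four blocks of a double sum.\<close>

lemma sum_over_two_halves:
  fixes f :: "nat \<Rightarrow> real"
  assumes "\<And>i. i \<in> {1..n} \<Longrightarrow> f i = a" "\<And>i. i \<in> {n + 1..n + n} \<Longrightarrow> f i = b"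
  shows "(\<Sum>i=1..n + n. f i) = real n * a + real n * b"
proof -
  have "(\<Sum>i=1..n + n. f i) = (\<Sum>i=1..n. f i) + (\<Sum>i=n + 1..n + n. f i)"
    by (rule sum.ub_add_nat) simp
  also have "\<dots> = (\<Sum>i=1..n. a) + (\<Sum>i=n + 1..n + n. b)" using assms by simp
  finally show ?thesis by simp
qed

text \<open>
  Negative type is applied to \<open>n\<close> independent points drawn from \<open>P\<close> with weight \<open>1\<close> and \<open>n\<close>
  drawn from \<open>Q\<close> with weight \<open>-1\<close>.  The diagonal contributes \<open>O(n)\<close> instead of the \<open>O(n\<^sup>2)\<close> of
  the energy distance and is negligible for large \<open>n\<close>.
\<close>

lemma negative_type_energy_nonneg:
  fixes \<delta> :: "'a \<Rightarrow> 'a \<Rightarrow> real"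
  assumes nt: "negative_type (space N) \<delta>"
    and meas: "case_prod \<delta> \<in> borel_measurable (N \<Otimes>\<^sub>M N)"
    and P: "prob_space P" "sets P = sets N" and Q: "prob_space Q" "sets Q = sets N"
    and iPP: "integrable (P \<Otimes>\<^sub>M P) (case_prod \<delta>)"
    and iPQ: "integrable (P \<Otimes>\<^sub>M Q) (case_prod \<delta>)"
    and iQQ: "integrable (Q \<Otimes>\<^sub>M Q) (case_prod \<delta>)"
  shows "integral\<^sup>L (P \<Otimes>\<^sub>M P) (case_prod \<delta>) + integral\<^sup>L (Q \<Otimes>\<^sub>M Q) (case_prod \<delta>)
    \<le> 2 * integral\<^sup>L (P \<Otimes>\<^sub>M Q) (case_prod \<delta>)"
proof -
  interpret P: prob_space P by fact
  interpret Q: prob_space Q by fact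
  interpret PQ: pair_sigma_finite P Q ..
  interpret \<delta>: Metric_space "space N" \<delta> using nt by (simp add: negative_type_def)
  \<comment> \<open>\<open>Metric_space\<close> demands symmetry for all arguments, so this is an
    equality of functions and not only one on the carrier.\<close>
  have swap: "(\<lambda>(x, y). (case_prod \<delta>) (y, x)) = case_prod \<delta>"
    by (auto simp: \<delta>.commute)
  have iQP: "integrable (Q \<Otimes>\<^sub>M P) (case_prod \<delta>)"
    using PQ.integrable_product_swap[OF iPQ] unfolding swap .
  define PP where "PP = integral\<^sup>L (P \<Otimes>\<^sub>M P) (case_prod \<delta>)"
  define QQ where "QQ = integral\<^sup>L (Q \<Otimes>\<^sub>M Q) (case_prod \<delta>)"
  define PQ where "PQ = integral\<^sup>L (P \<Otimes>\<^sub>M Q) (case_prod \<delta>)"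
  have QP: "integral\<^sup>L (Q \<Otimes>\<^sub>M P) (case_prod \<delta>) = PQ"
    using PQ.integral_product_swap[of "case_prod \<delta>"] iPQ unfolding swap PQ_def by auto
  \<comment> \<open>This is the expected inequality of negative type for \<open>n + n\<close>
    points, divided by \<open>n\<close>: the energy term grows like \<open>n\<close>, the diagonal
    correction stays fixed.\<close>
  have bound: "real n * (PP + QQ - 2 * PQ) \<le> PP + QQ" if n: "n \<ge> 1" for n
  proof -
    define \<mu> where "\<mu> = (\<lambda>i. if i \<le> n then P else Q)"
    define \<alpha> where "\<alpha> = (\<lambda>i. if i \<le> n then 1 else - 1 :: real)"
    define I where "I = {1..n + n}"
    define e where "e = (\<lambda>i j. integral\<^sup>L (\<mu> i \<Otimes>\<^sub>M \<mu> j) (case_prod \<delta>))"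
    have pr: "prob_space (\<mu> i)" for i using P Q by (simp add: \<mu>_def)
    interpret \<Pi>: product_prob_space \<mu> I
      by (intro product_prob_space.intro product_sigma_finite.intro
          product_prob_space_axioms.intro pr prob_space_imp_sigma_finite)
    have s\<mu>: "sets (\<mu> i) = sets N" for i using P Q by (simp add: \<mu>_def)
    have sp\<mu>: "space (\<mu> i) = space N" for i by (rule sets_eq_imp_space_eq[OF s\<mu>])
    have mp: "case_prod \<delta> \<in> borel_measurable (\<mu> i \<Otimes>\<^sub>M \<mu> j)" for i j
      using meas measurable_cong_sets[OF sets_pair_measure_cong[OF s\<mu> s\<mu>] refl] by blast
    have ip: "integrable (\<mu> i \<Otimes>\<^sub>M \<mu> j) (case_prod \<delta>)" for i j
      using iPP iPQ iQP iQQ by (simp add: \<mu>_def)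
    have in_sp: "\<omega> i \<in> space N" if "\<omega> \<in> space (PiM I \<mu>)" "i \<in> I" for \<omega> i
      using that by (auto simp: space_PiM sp\<mu> PiE_iff)
    have comp: "(\<lambda>\<omega>. (\<omega> i, \<omega> j)) \<in> measurable (PiM I \<mu>) (\<mu> i \<Otimes>\<^sub>M \<mu> j)"
      if "i \<in> I" "j \<in> I" for i j
      using that by measurable
    have off: "integrable (PiM I \<mu>) (\<lambda>\<omega>. \<delta> (\<omega> i) (\<omega> j))
        \<and> (\<integral>\<omega>. \<delta> (\<omega> i) (\<omega> j) \<partial>PiM I \<mu>) = e i j"
      if ij: "i \<in> I" "j \<in> I" "i \<noteq> j" for i j
    proof -
      note D = \<Pi>.distr_PiM_pair_component[OF ij]
      have "integrable (PiM I \<mu>) (\<lambda>\<omega>. case_prod \<delta> (\<omega> i, \<omega> j))"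
        using integrable_distr_eq[OF comp[OF ij(1,2)] mp] ip[of i j] unfolding D by simp
      moreover have "(\<integral>\<omega>. case_prod \<delta> (\<omega> i, \<omega> j) \<partial>PiM I \<mu>) = e i j"
        using integral_distr[OF comp[OF ij(1,2)] mp] unfolding D e_def by simp
      ultimately show ?thesis by simp
    qed
    have diag: "\<delta> (\<omega> i) (\<omega> i) = 0" if "\<omega> \<in> space (PiM I \<mu>)" "i \<in> I" for \<omega> i
      using in_sp[OF that] by simp
    have all: "integrable (PiM I \<mu>) (\<lambda>\<omega>. \<delta> (\<omega> i) (\<omega> j))
        \<and> (\<integral>\<omega>. \<delta> (\<omega> i) (\<omega> j) \<partial>PiM I \<mu>) = (if i = j then 0 else e i j)"
      if ij: "i \<in> I" "j \<in> I" for i j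
    proof (cases "i = j")
      case True
      have "integrable (PiM I \<mu>) (\<lambda>\<omega>. \<delta> (\<omega> i) (\<omega> i)) \<longleftrightarrow> integrable (PiM I \<mu>) (\<lambda>\<omega>. 0 :: real)"
        using ij by (intro Bochner_Integration.integrable_cong refl) (simp add: diag)
      moreover have "(\<integral>\<omega>. \<delta> (\<omega> i) (\<omega> i) \<partial>PiM I \<mu>) = (\<integral>\<omega>. 0 \<partial>PiM I \<mu>)"
        using ij by (intro Bochner_Integration.integral_cong refl) (simp add: diag)
      ultimately show ?thesis using True by simp
    qed (use off ij in auto)
    have sum_halves: "(\<Sum>i\<in>I. f i) = real n * a + real n * b"
      if "\<And>i. i \<in> {1..n} \<Longrightarrow> f i = a" "\<And>i. i \<in> {n + 1..n + n} \<Longrightarrow> f i = b"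
      for f :: "nat \<Rightarrow> real" and a b
      unfolding I_def using that by (rule sum_over_two_halves)
    have \<alpha>0: "(\<Sum>i\<in>I. \<alpha> i) = 0"
      using sum_halves[of \<alpha> 1 "- 1"] by (simp add: \<alpha>_def)
    have le0: "(\<Sum>i\<in>I. \<Sum>j\<in>I. \<alpha> i * \<alpha> j * \<delta> (\<omega> i) (\<omega> j)) \<le> 0"
      if "\<omega> \<in> space (PiM I \<mu>)" for \<omega>
    proof -
      have "\<omega> ` {1..n + n} \<subseteq> space N" using in_sp[OF that] by (auto simp: I_def)
      moreover have "n + n \<ge> 1" using n by simp
      ultimately show ?thesis using nt \<alpha>0 unfolding negative_type_def I_def by blast
    qed
    \<comment> \<open>Negative type holds at every sample point, so the integral of the quadratic
      form is nonpositive; linearity evaluates it term by term.\<close>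
    have "(\<Sum>i\<in>I. \<Sum>j\<in>I. \<alpha> i * \<alpha> j * (if i = j then 0 else e i j))
        = (\<integral>\<omega>. (\<Sum>i\<in>I. \<Sum>j\<in>I. \<alpha> i * \<alpha> j * \<delta> (\<omega> i) (\<omega> j)) \<partial>PiM I \<mu>)"
      using all by (simp add: Bochner_Integration.integral_sum)
    also have "\<dots> \<le> 0"
      using Bochner_Integration.integral_nonneg[of "PiM I \<mu>"
          "\<lambda>\<omega>. - (\<Sum>i\<in>I. \<Sum>j\<in>I. \<alpha> i * \<alpha> j * \<delta> (\<omega> i) (\<omega> j))"] le0 by simp
    finally have "(\<Sum>i\<in>I. \<Sum>j\<in>I. \<alpha> i * \<alpha> j * (if i = j then 0 else e i j)) \<le> 0" .
    \<comment> \<open>On the diagonal the distance is 0, whereas \<open>e i i\<close> is the mean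
      distance of two independent draws. Inserting \<open>e i i\<close> and subtracting it again
      leaves a full double sum that is constant on the four blocks.\<close>
    moreover have "(\<Sum>i\<in>I. \<Sum>j\<in>I. \<alpha> i * \<alpha> j * (if i = j then 0 else e i j))
        = (\<Sum>i\<in>I. \<Sum>j\<in>I. \<alpha> i * \<alpha> j * e i j) - (\<Sum>i\<in>I. \<alpha> i * \<alpha> i * e i i)"
    proof -
      have "(\<Sum>j\<in>I. \<alpha> i * \<alpha> j * (if i = j then 0 else e i j))
          = (\<Sum>j\<in>I. \<alpha> i * \<alpha> j * e i j) - \<alpha> i * \<alpha> i * e i i" if "i \<in> I" for i
      proof -
        have "(\<Sum>j\<in>I. \<alpha> i * \<alpha> j * (if i = j then 0 else e i j))
            = (\<Sum>j\<in>I. \<alpha> i * \<alpha> j * e i j - (if j = i then \<alpha> i * \<alpha> j * e i j else 0))"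
          by (intro sum.cong) auto
        then show ?thesis using that by (simp add: sum_subtractf I_def)
      qed
      then show ?thesis by (simp add: sum_subtractf)
    qed
    moreover have "(\<Sum>i\<in>I. \<alpha> i * \<alpha> i * e i i) = real n * PP + real n * QQ"
      by (rule sum_halves) (auto simp: \<alpha>_def e_def \<mu>_def PP_def QQ_def)
    \<comment> \<open>The blocks have \<open>n * n\<close> entries each: sign \<open>+\<close>
      within a sample, sign \<open>-\<close> across the two samples.\<close>
    moreover have "(\<Sum>i\<in>I. \<Sum>j\<in>I. \<alpha> i * \<alpha> j * e i j)
        = real n * (real n * PP + real n * (- PQ)) + real n * (real n * (- PQ) + real n * QQ)"
      by (intro sum_halves)
        (auto simp: \<alpha>_def e_def \<mu>_def PP_def QQ_def PQ_def QP[unfolded PQ_def])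
    ultimately have "real n * (real n * (PP + QQ - 2 * PQ)) \<le> real n * (PP + QQ)"
      by (simp add: algebra_simps)
    then show ?thesis using n by simp
  qed
  have "PP + QQ - 2 * PQ \<le> 0"
  proof (rule ccontr)
    assume pos: "\<not> PP + QQ - 2 * PQ \<le> 0"
    then obtain n where n: "real n * (PP + QQ - 2 * PQ) > PP + QQ"
      using reals_Archimedean3[of "PP + QQ - 2 * PQ"] by auto
    \<comment> \<open>The Archimedean \<open>n\<close> may be 0, while \<open>bound\<close> asks for
      a positive index. Moving to \<open>Suc n\<close> only enlarges the left side, because the
      assumed gap is positive.\<close>
    have "real n * (PP + QQ - 2 * PQ) \<le> real (Suc n) * (PP + QQ - 2 * PQ)"
      using pos by (intro mult_right_mono) auto
    with n bound[of "Suc n"] show False by simp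
  qed
  then show ?thesis by (simp add: PP_def QQ_def PQ_def)
qed

text \<open>The joint law of an independent pair is the product of the marginal laws, so both claims
  are a change of variables along \<open>(U, V)\<close>.\<close>

lemma (in prob_space) indep_var_integral_pair:
  fixes f :: "'b \<times> 'b \<Rightarrow> real"
  assumes ind: "indep_var S U T V" and f: "f \<in> borel_measurable (S \<Otimes>\<^sub>M T)"
  shows "integrable M (\<lambda>\<omega>. f (U \<omega>, V \<omega>)) \<longleftrightarrow> integrable (distr M S U \<Otimes>\<^sub>M distr M T V) f"
    and "expectation (\<lambda>\<omega>. f (U \<omega>, V \<omega>)) = integral\<^sup>L (distr M S U \<Otimes>\<^sub>M distr M T V) f"
proof -
  have rv: "(\<lambda>\<omega>. (U \<omega>, V \<omega>)) \<in> measurable M (S \<Otimes>\<^sub>M T)"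
    using indep_var_rv1[OF ind] indep_var_rv2[OF ind] by measurable
  have eq: "distr M S U \<Otimes>\<^sub>M distr M T V = distr M (S \<Otimes>\<^sub>M T) (\<lambda>\<omega>. (U \<omega>, V \<omega>))"
    using ind by (simp add: indep_var_distribution_eq)
  show "integrable M (\<lambda>\<omega>. f (U \<omega>, V \<omega>)) \<longleftrightarrow> integrable (distr M S U \<Otimes>\<^sub>M distr M T V) f"
    unfolding eq using integrable_distr_eq[OF rv f] by simp
  show "expectation (\<lambda>\<omega>. f (U \<omega>, V \<omega>)) = integral\<^sup>L (distr M S U \<Otimes>\<^sub>M distr M T V) f"
    unfolding eq using integral_distr[OF rv f] by simp
qed

text \<open>A space of mass 1 is not a null set. This turns the almost-everywhere statements of
  Fubini's theorem into the choice of one good point.\<close>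

lemma (in prob_space) AE_imp_ex: "AE x in M. R x \<Longrightarrow> \<exists>x\<in>space M. R x"
proof (rule ccontr)
  assume ae: "AE x in M. R x" and "\<not> (\<exists>x\<in>space M. R x)"
  then have "AE x in M. False" using AE_space by (auto elim!: eventually_rev_mp)
  then show False by simp
qed

text \<open>By Fubini almost every section \<open>\<delta> x\<close> is integrable, and one such
  base point is all that a finite first moment asks for.\<close>

lemma finite_first_moment_of_pair_integrable:
  fixes \<delta> :: "'a \<Rightarrow> 'a \<Rightarrow> real"
  assumes "prob_space P" "integrable (P \<Otimes>\<^sub>M P) (case_prod \<delta>)"
  shows "finite_first_moment \<delta> P"
proof -
  interpret P: prob_space P by fact
  interpret PP: pair_sigma_finite P P ..
  have "AE x in P. integrable P (\<delta> x)"
    using PP.AE_integrable_fst'[OF assms(2)] by simp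
  then show ?thesis unfolding finite_first_moment_def by (rule P.AE_imp_ex)
qed

text \<open>Independence turns the three expectations into double integrals of
  \<open>\<delta>\<close> against the laws of \<open>U\<close> and \<open>V\<close>. Their
  combination is the energy distance of these laws: nonnegative by negative type, zero only for
  equal laws by strong negative type.\<close>

lemma (in prob_space) strong_negative_type_energy:
  assumes snt: "strong_negative_type N \<delta>"
    and meas: "case_prod \<delta> \<in> borel_measurable (N \<Otimes>\<^sub>M N)"
    and UV: "indep_var N U N V" and UU': "indep_var N U N U'" and VV': "indep_var N V N V'"
    and U': "distr M N U' = distr M N U" and V': "distr M N V' = distr M N V"
    and int: "integrable M (\<lambda>\<omega>. \<delta> (U \<omega>) (V \<omega>))" "integrable M (\<lambda>\<omega>. \<delta> (U \<omega>) (U' \<omega>))"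
      "integrable M (\<lambda>\<omega>. \<delta> (V \<omega>) (V' \<omega>))"
  shows "expectation (\<lambda>\<omega>. \<delta> (U \<omega>) (U' \<omega>)) + expectation (\<lambda>\<omega>. \<delta> (V \<omega>) (V' \<omega>))
      \<le> 2 * expectation (\<lambda>\<omega>. \<delta> (U \<omega>) (V \<omega>))" (is ?le)
    and "expectation (\<lambda>\<omega>. \<delta> (U \<omega>) (U' \<omega>)) + expectation (\<lambda>\<omega>. \<delta> (V \<omega>) (V' \<omega>))
      = 2 * expectation (\<lambda>\<omega>. \<delta> (U \<omega>) (V \<omega>)) \<longleftrightarrow> distr M N U = distr M N V" (is ?eq)
    and "distr M N U = distr M N V \<Longrightarrow>
      expectation (\<lambda>\<omega>. \<delta> (U \<omega>) (U' \<omega>)) = expectation (\<lambda>\<omega>. \<delta> (V \<omega>) (V' \<omega>))"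
proof -
  define P where "P = distr M N U"
  define Q where "Q = distr M N V"
  have P: "prob_space P" "sets P = sets N" and Q: "prob_space Q" "sets Q = sets N"
    using indep_var_rv1[OF UV] indep_var_rv2[OF UV] by (auto simp: P_def Q_def prob_space_distr)
  note pair = indep_var_integral_pair[OF _ meas, simplified]
  have iPQ: "integrable (P \<Otimes>\<^sub>M Q) (case_prod \<delta>)"
    and iPP: "integrable (P \<Otimes>\<^sub>M P) (case_prod \<delta>)"
    and iQQ: "integrable (Q \<Otimes>\<^sub>M Q) (case_prod \<delta>)"
    using int pair(1)[OF UV] pair(1)[OF UU'] pair(1)[OF VV'] by (auto simp: P_def Q_def U' V')
  have E: "expectation (\<lambda>\<omega>. \<delta> (U \<omega>) (V \<omega>)) = integral\<^sup>L (P \<Otimes>\<^sub>M Q) (case_prod \<delta>)"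
    "expectation (\<lambda>\<omega>. \<delta> (U \<omega>) (U' \<omega>)) = integral\<^sup>L (P \<Otimes>\<^sub>M P) (case_prod \<delta>)"
    "expectation (\<lambda>\<omega>. \<delta> (V \<omega>) (V' \<omega>)) = integral\<^sup>L (Q \<Otimes>\<^sub>M Q) (case_prod \<delta>)"
    using pair(2)[OF UV] pair(2)[OF UU'] pair(2)[OF VV'] by (auto simp: P_def Q_def U' V')
  have nt: "negative_type (space N) \<delta>" using snt by (simp add: strong_negative_type_def)
  show ?le unfolding E by (rule negative_type_energy_nonneg[OF nt meas P Q iPP iPQ iQQ])
  show ?eq
  proof
    assume eq: "expectation (\<lambda>\<omega>. \<delta> (U \<omega>) (U' \<omega>)) + expectation (\<lambda>\<omega>. \<delta> (V \<omega>) (V' \<omega>))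
      = 2 * expectation (\<lambda>\<omega>. \<delta> (U \<omega>) (V \<omega>))"
    interpret P: prob_space P by (rule P)
    interpret Q: prob_space Q by (rule Q)
    interpret PQ: pair_sigma_finite P Q ..
    interpret PP: pair_sigma_finite P P ..
    interpret QQ: pair_sigma_finite Q Q ..
    \<comment> \<open>Strong negative type is phrased with iterated integrals; Fubini passes to them
      from the product measures.\<close>
    have "2 * (\<integral>x. (\<integral>y. \<delta> x y \<partial>Q) \<partial>P)
        - (\<integral>x. (\<integral>y. \<delta> x y \<partial>P) \<partial>P) - (\<integral>x. (\<integral>y. \<delta> x y \<partial>Q) \<partial>Q) = 0"
      using eq PQ.integral_fst'[OF iPQ] PP.integral_fst'[OF iPP] QQ.integral_fst'[OF iQQ]
      unfolding E by simp
    then have "P = Q"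
      using snt P Q finite_first_moment_of_pair_integrable[OF P(1) iPP]
        finite_first_moment_of_pair_integrable[OF Q(1) iQQ]
      unfolding strong_negative_type_def by blast
    then show "distr M N U = distr M N V" by (simp add: P_def Q_def)
  next
    assume "distr M N U = distr M N V"
    then show "expectation (\<lambda>\<omega>. \<delta> (U \<omega>) (U' \<omega>)) + expectation (\<lambda>\<omega>. \<delta> (V \<omega>) (V' \<omega>))
      = 2 * expectation (\<lambda>\<omega>. \<delta> (U \<omega>) (V \<omega>))"
      unfolding E by (simp add: P_def Q_def)
  qed
  show "expectation (\<lambda>\<omega>. \<delta> (U \<omega>) (U' \<omega>)) = expectation (\<lambda>\<omega>. \<delta> (V \<omega>) (V' \<omega>))"
    if "distr M N U = distr M N V"
    unfolding E using that by (simp add: P_def Q_def)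
qed

text \<open>Independence and equality in law survive applying one measurable map to every vector.
  The map \<open>g\<close> will be the projection to a group in Case S1 and to a single coordinate
  in Case S2.\<close>

lemma (in prob_space) indep_copy_compose:
  assumes XY: "indep_var S X S Y"
    and ind: "indep_var (S \<Otimes>\<^sub>M S) (\<lambda>\<omega>. (X \<omega>, Y \<omega>)) (S \<Otimes>\<^sub>M S) (\<lambda>\<omega>. (X' \<omega>, Y' \<omega>))"
    and copy: "distr M (S \<Otimes>\<^sub>M S) (\<lambda>\<omega>. (X' \<omega>, Y' \<omega>)) = distr M (S \<Otimes>\<^sub>M S) (\<lambda>\<omega>. (X \<omega>, Y \<omega>))"
    and g: "g \<in> measurable S N"
  shows "indep_var N (\<lambda>\<omega>. g (X \<omega>)) N (\<lambda>\<omega>. g (Y \<omega>))"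
    and "indep_var N (\<lambda>\<omega>. g (X \<omega>)) N (\<lambda>\<omega>. g (X' \<omega>))"
    and "indep_var N (\<lambda>\<omega>. g (Y \<omega>)) N (\<lambda>\<omega>. g (Y' \<omega>))"
    and "distr M N (\<lambda>\<omega>. g (X' \<omega>)) = distr M N (\<lambda>\<omega>. g (X \<omega>))"
    and "distr M N (\<lambda>\<omega>. g (Y' \<omega>)) = distr M N (\<lambda>\<omega>. g (Y \<omega>))"
proof -
  have g1: "(\<lambda>z. g (fst z)) \<in> measurable (S \<Otimes>\<^sub>M S) N" and g2: "(\<lambda>z. g (snd z)) \<in> measurable (S \<Otimes>\<^sub>M S) N"
    using g by measurable
  show "indep_var N (\<lambda>\<omega>. g (X \<omega>)) N (\<lambda>\<omega>. g (Y \<omega>))"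
    using indep_var_compose[OF XY g g] by (simp add: comp_def)
  show "indep_var N (\<lambda>\<omega>. g (X \<omega>)) N (\<lambda>\<omega>. g (X' \<omega>))"
    using indep_var_compose[OF ind g1 g1] by (simp add: comp_def)
  show "indep_var N (\<lambda>\<omega>. g (Y \<omega>)) N (\<lambda>\<omega>. g (Y' \<omega>))"
    using indep_var_compose[OF ind g2 g2] by (simp add: comp_def)
  note rv = indep_var_rv1[OF ind] indep_var_rv2[OF ind]
  have "distr (distr M (S \<Otimes>\<^sub>M S) (\<lambda>\<omega>. (X' \<omega>, Y' \<omega>))) N h
      = distr (distr M (S \<Otimes>\<^sub>M S) (\<lambda>\<omega>. (X \<omega>, Y \<omega>))) N h" for h
    by (simp only: copy)
  from this[of "\<lambda>z. g (fst z)"] this[of "\<lambda>z. g (snd z)"]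
  show "distr M N (\<lambda>\<omega>. g (X' \<omega>)) = distr M N (\<lambda>\<omega>. g (X \<omega>))"
    "distr M N (\<lambda>\<omega>. g (Y' \<omega>)) = distr M N (\<lambda>\<omega>. g (Y \<omega>))"
    by (simp_all add: distr_distr[OF g1 rv(1)] distr_distr[OF g1 rv(2)]
        distr_distr[OF g2 rv(1)] distr_distr[OF g2 rv(2)] comp_def)
qed

text \<open>Fubini fixes a value \<open>c\<close> of the first variable for which the square of
  \<open>c - V\<close> is integrable, and the square of \<open>V\<close> is at most twice that plus
  twice the square of \<open>c\<close>. In this way finite distances yield finite second
  moments.\<close>

lemma (in prob_space) square_integrable_of_indep_diff:
  fixes U V :: "'a \<Rightarrow> real"
  assumes ind: "indep_var borel U borel V" and int: "integrable M (\<lambda>\<omega>. (U \<omega> - V \<omega>)\<^sup>2)"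
  shows "integrable M (\<lambda>\<omega>. (V \<omega>)\<^sup>2)"
proof -
  note rv [measurable] = indep_var_rv1[OF ind] indep_var_rv2[OF ind]
  define P where "P = distr M borel U"
  define Q where "Q = distr M borel V"
  interpret P: prob_space P unfolding P_def by (rule prob_space_distr) simp
  interpret Q: prob_space Q unfolding Q_def by (rule prob_space_distr) simp
  interpret PQ: pair_sigma_finite P Q ..
  have "integrable (P \<Otimes>\<^sub>M Q) (\<lambda>z. (fst z - snd z)\<^sup>2)"
    using indep_var_integral_pair(1)[OF ind, of "\<lambda>z. (fst z - snd z)\<^sup>2"] int
    by (simp add: P_def Q_def)
  from PQ.AE_integrable_fst'[OF this]
  obtain c where "integrable Q (\<lambda>y. (c - y)\<^sup>2)"
    using P.AE_imp_ex by auto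
  then have "integrable M (\<lambda>\<omega>. (c - V \<omega>)\<^sup>2)"
    unfolding Q_def by (subst (asm) integrable_distr_eq) auto
  then have "integrable M (\<lambda>\<omega>. 2 * (c - V \<omega>)\<^sup>2 + 2 * c\<^sup>2)" by simp
  then show ?thesis
  proof (rule Bochner_Integration.integrable_bound)
    have "v\<^sup>2 \<le> 2 * (c - v)\<^sup>2 + 2 * c\<^sup>2" for v :: real
    proof -
      have "2 * (c - v)\<^sup>2 + 2 * c\<^sup>2 - v\<^sup>2 = (2 * c - v)\<^sup>2"
        by (simp add: power2_eq_square algebra_simps)
      then show ?thesis by (metis diff_ge_0_iff_ge zero_le_power2)
    qed
    then show "AE \<omega> in M. norm ((V \<omega>)\<^sup>2) \<le> norm (2 * (c - V \<omega>)\<^sup>2 + 2 * c\<^sup>2)" by simp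
  qed simp
qed

text \<open>After expanding the square, independence factors the mixed moment into
  \<open>expectation U * expectation V\<close>.\<close>

lemma (in prob_space) expectation_indep_diff_square:
  fixes U V :: "'a \<Rightarrow> real"
  assumes ind: "indep_var borel U borel V"
    and U2: "integrable M (\<lambda>\<omega>. (U \<omega>)\<^sup>2)" and V2: "integrable M (\<lambda>\<omega>. (V \<omega>)\<^sup>2)"
  shows "expectation (\<lambda>\<omega>. (U \<omega> - V \<omega>)\<^sup>2) = (expectation U - expectation V)\<^sup>2 + variance U + variance V"
proof -
  note rv [measurable] = indep_var_rv1[OF ind] indep_var_rv2[OF ind]
  have U: "integrable M U" and V: "integrable M V"
    using U2 V2 by (auto intro: square_integrable_imp_integrable)
  have "(\<lambda>\<omega>. (U \<omega> - V \<omega>)\<^sup>2) = (\<lambda>\<omega>. (U \<omega>)\<^sup>2 + (V \<omega>)\<^sup>2 - 2 * (U \<omega> * V \<omega>))"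
    by (auto simp: power2_diff)
  then have "expectation (\<lambda>\<omega>. (U \<omega> - V \<omega>)\<^sup>2)
      = expectation (\<lambda>\<omega>. (U \<omega>)\<^sup>2) + expectation (\<lambda>\<omega>. (V \<omega>)\<^sup>2) - 2 * (expectation U * expectation V)"
    using U2 V2 indep_var_integrable[OF ind U V] indep_var_lebesgue_integral[OF ind U V] by simp
  then show ?thesis
    unfolding variance_eq[OF U U2] variance_eq[OF V V2] by (simp add: power2_diff)
qed

text \<open>Twice the first value minus the other two is twice the squared difference of the means:
  the variances cancel, so the energy distance of squared Euclidean distance sees only the
  means.\<close>

lemma (in prob_space) indep_copy_diff_square:
  fixes U V U' V' :: "'a \<Rightarrow> real"
  assumes UV: "indep_var borel U borel V" and UU': "indep_var borel U borel U'"
    and VV': "indep_var borel V borel V'"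
    and U': "distr M borel U' = distr M borel U" and V': "distr M borel V' = distr M borel V"
    and int: "integrable M (\<lambda>\<omega>. (U \<omega> - U' \<omega>)\<^sup>2)" "integrable M (\<lambda>\<omega>. (V \<omega> - V' \<omega>)\<^sup>2)"
  shows "expectation (\<lambda>\<omega>. (U \<omega> - V \<omega>)\<^sup>2) = (expectation U - expectation V)\<^sup>2 + variance U + variance V"
    and "expectation (\<lambda>\<omega>. (U \<omega> - U' \<omega>)\<^sup>2) = 2 * variance U"
    and "expectation (\<lambda>\<omega>. (V \<omega> - V' \<omega>)\<^sup>2) = 2 * variance V"
proof -
  have transfer: "expectation (\<lambda>\<omega>. f (W' \<omega>)) = expectation (\<lambda>\<omega>. f (W \<omega>))
      \<and> (integrable M (\<lambda>\<omega>. f (W' \<omega>)) \<longleftrightarrow> integrable M (\<lambda>\<omega>. f (W \<omega>)))"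
    if W: "indep_var borel W borel W'" and eq: "distr M borel W' = distr M borel W"
      and f: "f \<in> borel_measurable borel" for W W' and f :: "real \<Rightarrow> real"
    using integral_distr[OF indep_var_rv1[OF W] f] integral_distr[OF indep_var_rv2[OF W] f]
      integrable_distr_eq[OF indep_var_rv1[OF W] f] integrable_distr_eq[OF indep_var_rv2[OF W] f]
    unfolding eq by simp
  have same: "integrable M (\<lambda>\<omega>. (W \<omega>)\<^sup>2) \<and> expectation (\<lambda>\<omega>. (W \<omega> - W' \<omega>)\<^sup>2) = 2 * variance W"
    if W: "indep_var borel W borel W'" and eq: "distr M borel W' = distr M borel W"
      and int: "integrable M (\<lambda>\<omega>. (W \<omega> - W' \<omega>)\<^sup>2)" for W W' :: "'a \<Rightarrow> real"
  proof -
    note tr = transfer[OF W eq]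
    \<comment> \<open>The Fubini argument controls the second variable of the pair, here the copy;
      equality in law then carries the second moment back to \<open>W\<close>.\<close>
    have W'2: "integrable M (\<lambda>\<omega>. (W' \<omega>)\<^sup>2)" by (rule square_integrable_of_indep_diff[OF W int])
    then have W2: "integrable M (\<lambda>\<omega>. (W \<omega>)\<^sup>2)" using tr[of "\<lambda>x. x\<^sup>2"] by simp
    have e: "expectation W' = expectation W" using tr[of "\<lambda>x. x"] by simp
    have v: "variance W' = variance W"
      using tr[of "\<lambda>x. (x - expectation W)\<^sup>2"] unfolding e by simp
    show ?thesis using W2 expectation_indep_diff_square[OF W W2 W'2] unfolding v by (simp add: e)
  qed
  note sU = same[OF UU' U' int(1)] and sV = same[OF VV' V' int(2)]
  show "expectation (\<lambda>\<omega>. (U \<omega> - U' \<omega>)\<^sup>2) = 2 * variance U" using sU by simp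
  show "expectation (\<lambda>\<omega>. (V \<omega> - V' \<omega>)\<^sup>2) = 2 * variance V" using sV by simp
  show "expectation (\<lambda>\<omega>. (U \<omega> - V \<omega>)\<^sup>2) = (expectation U - expectation V)\<^sup>2 + variance U + variance V"
    using expectation_indep_diff_square[OF UV] sU sV by simp
qed

text \<open>Each nonnegative summand is dominated by the sum. This extracts the groups or
  coordinates from the integrable squared distance.\<close>

lemma integrable_sum_nonneg:
  fixes f :: "'i \<Rightarrow> 'a \<Rightarrow> real"
  assumes int: "integrable M (\<lambda>x. \<Sum>i\<in>I. f i x)" and "finite I" "i \<in> I"
    and meas: "f i \<in> borel_measurable M"
    and nonneg: "\<And>i x. i \<in> I \<Longrightarrow> x \<in> space M \<Longrightarrow> 0 \<le> f i x"
  shows "integrable M (f i)"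
proof (rule Bochner_Integration.integrable_bound[OF int meas], rule AE_I2)
  fix x assume x: "x \<in> space M"
  have "f i x \<le> (\<Sum>i\<in>I. f i x)"
    using assms x by (intro member_le_sum) auto
  then show "norm (f i x) \<le> norm (\<Sum>i\<in>I. f i x)"
    using nonneg[OF assms(3) x] by simp
qed

theorem lemma4p1:
  fixes M :: "'w measure"
    and p :: nat and d :: "nat \<Rightarrow> nat"
    and \<rho> :: "nat \<Rightarrow> (nat \<Rightarrow> real) \<Rightarrow> (nat \<Rightarrow> real) \<Rightarrow> real"
    and X Y X' Y' :: "'w \<Rightarrow> nat \<Rightarrow> nat \<Rightarrow> real"
    and \<tau> \<tau>\<^sub>X \<tau>\<^sub>Y :: real
  assumes "p \<ge> 1" and "\<forall>i\<in>{1..p}. d i \<ge> 1"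
    and "prob_space M"
    and "prob_space.indep_var M (grouped p d) X (grouped p d) Y"
    and "prob_space.indep_var M
           (grouped p d \<Otimes>\<^sub>M grouped p d) (\<lambda>\<omega>. (X \<omega>, Y \<omega>))
           (grouped p d \<Otimes>\<^sub>M grouped p d) (\<lambda>\<omega>. (X' \<omega>, Y' \<omega>))"
    and "distr M (grouped p d \<Otimes>\<^sub>M grouped p d) (\<lambda>\<omega>. (X' \<omega>, Y' \<omega>))
       = distr M (grouped p d \<Otimes>\<^sub>M grouped p d) (\<lambda>\<omega>. (X \<omega>, Y \<omega>))"
    and "integrable M (\<lambda>\<omega>. (K_dist p \<rho> (X \<omega>) (Y \<omega>))\<^sup>2)"
    and "integrable M (\<lambda>\<omega>. (K_dist p \<rho> (X \<omega>) (X' \<omega>))\<^sup>2)"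
    and "integrable M (\<lambda>\<omega>. (K_dist p \<rho> (Y \<omega>) (Y' \<omega>))\<^sup>2)"
    and "\<tau> = rms_dist M (K_dist p \<rho>) X Y"
    and "\<tau>\<^sub>X = rms_dist M (K_dist p \<rho>) X X'"
    and "\<tau>\<^sub>Y = rms_dist M (K_dist p \<rho>) Y Y'"
  shows
    "((\<forall>i\<in>{1..p}. strong_negative_type (Rn (d i)) (\<rho> i) \<and>
         (\<lambda>(x, y). \<rho> i x y) \<in> borel_measurable (Rn (d i) \<Otimes>\<^sub>M Rn (d i))) \<longrightarrow>
       (2 * \<tau> - \<tau>\<^sub>X - \<tau>\<^sub>Y = 0 \<longleftrightarrow>
        (\<forall>i\<in>{1..p}. distr M (Rn (d i)) (\<lambda>\<omega>. X \<omega> i) = distr M (Rn (d i)) (\<lambda>\<omega>. Y \<omega> i))))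
     \<and>
     ((\<forall>i\<in>{1..p}. \<forall>x\<in>space (Rn (d i)). \<forall>y\<in>space (Rn (d i)).
         \<rho> i x y = (L2_set (\<lambda>j. x j - y j) {1..d i})\<^sup>2) \<longrightarrow>
       (2 * \<tau> - \<tau>\<^sub>X - \<tau>\<^sub>Y = 0 \<longleftrightarrow>
        mean_vec M p d X = mean_vec M p d Y \<and>
        trace_on (coords p d) (cov_mat M p d X) = trace_on (coords p d) (cov_mat M p d Y)))"
proof -
  define G where "G = grouped p d"
  interpret prob_space M by fact
  note XY = assms(4)[folded G_def] and ind = assms(5)[folded G_def] and copy = assms(6)[folded G_def]
  note compose = indep_copy_compose[OF XY ind copy]
  have comp: "(\<lambda>x. x i) \<in> measurable G (Rn (d i))" if "i \<in> {1..p}" for i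
    unfolding G_def grouped_def using that by measurable
  have comp2: "(\<lambda>x. x i j) \<in> borel_measurable G" if "i \<in> {1..p}" "j \<in> {1..d i}" for i j
  proof -
    have "(\<lambda>y. y j) \<in> borel_measurable (Rn (d i))" unfolding Rn_def using that by measurable
    from measurable_compose[OF comp[OF that(1)] this] show ?thesis .
  qed
  have rv: "X \<in> measurable M G" "Y \<in> measurable M G" "X' \<in> measurable M G" "Y' \<in> measurable M G"
    using indep_var_rv1[OF XY] indep_var_rv2[OF XY]
      measurable_compose[OF indep_var_rv2[OF ind] measurable_fst]
      measurable_compose[OF indep_var_rv2[OF ind] measurable_snd] by auto
  \<comment> \<open>Case S2 prescribes \<open>\<rho> i\<close> only on the carrier, so the groups of
    the random vectors have to be located there.\<close>
  have sp: "W \<omega> i \<in> space (Rn (d i))"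
    if "W \<in> measurable M G" "\<omega> \<in> space M" "i \<in> {1..p}" for W :: "'w \<Rightarrow> nat \<Rightarrow> nat \<Rightarrow> real" and \<omega> i
    using measurable_space[OF comp[OF that(3)]] measurable_space[OF that(1,2)] by simp
  show ?thesis
  proof (intro conjI impI)

    \<comment> \<open>Case S1: group-wise energy distances of strong negative type\<close>
    assume S1: "\<forall>i\<in>{1..p}. strong_negative_type (Rn (d i)) (\<rho> i) \<and>
      (\<lambda>(x, y). \<rho> i x y) \<in> borel_measurable (Rn (d i) \<Otimes>\<^sub>M Rn (d i))"
    \<comment> \<open>Nonnegativity holds for all arguments of a \<open>Metric_space\<close>, which
      makes \<open>K2\<close> below an unconditional identity.\<close>
    have nonneg: "0 \<le> \<rho> i x y" if "i \<in> {1..p}" for i x y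
    proof -
      have "Metric_space (space (Rn (d i))) (\<rho> i)"
        using S1 that by (simp add: strong_negative_type_def negative_type_def)
      then show ?thesis by (rule Metric_space.nonneg)
    qed
    have K2: "(K_dist p \<rho> x y)\<^sup>2 = (\<Sum>i=1..p. \<rho> i (x i) (y i))" for x y
      unfolding K_dist_def by (intro real_sqrt_pow2 sum_nonneg nonneg)
    have meas: "(\<lambda>\<omega>. \<rho> i (U \<omega> i) (V \<omega> i)) \<in> borel_measurable M"
      if "U \<in> measurable M G" "V \<in> measurable M G" "i \<in> {1..p}" for U V i
    proof -
      have m: "case_prod (\<rho> i) \<in> borel_measurable (Rn (d i) \<Otimes>\<^sub>M Rn (d i))"
        using S1 that(3) by auto
      have "(\<lambda>\<omega>. (U \<omega> i, V \<omega> i)) \<in> measurable M (Rn (d i) \<Otimes>\<^sub>M Rn (d i))"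
        using measurable_compose[OF that(1) comp[OF that(3)]]
          measurable_compose[OF that(2) comp[OF that(3)]] by measurable
      from measurable_compose[OF this m] show ?thesis by simp
    qed
    have term_int: "integrable M (\<lambda>\<omega>. \<rho> i (U \<omega> i) (V \<omega> i))"
      if "integrable M (\<lambda>\<omega>. (K_dist p \<rho> (U \<omega>) (V \<omega>))\<^sup>2)"
        "U \<in> measurable M G" "V \<in> measurable M G" "i \<in> {1..p}" for U V i
      using that unfolding K2
      by (intro integrable_sum_nonneg[where I = "{1..p}" and f = "\<lambda>i \<omega>. \<rho> i (U \<omega> i) (V \<omega> i)"])
        (auto intro: meas nonneg)
    define c where "c = (\<lambda>i. expectation (\<lambda>\<omega>. \<rho> i (X \<omega> i) (Y \<omega> i)))"
    define a where "a = (\<lambda>i. expectation (\<lambda>\<omega>. \<rho> i (X \<omega> i) (X' \<omega> i)))"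
    define b where "b = (\<lambda>i. expectation (\<lambda>\<omega>. \<rho> i (Y \<omega> i) (Y' \<omega> i)))"
    have t: "\<tau> = sqrt (\<Sum>i=1..p. c i)" "\<tau>\<^sub>X = sqrt (\<Sum>i=1..p. a i)" "\<tau>\<^sub>Y = sqrt (\<Sum>i=1..p. b i)"
      unfolding assms(10-12) rms_dist_def K2 a_def b_def c_def
      using term_int[OF assms(7) rv(1,2)] term_int[OF assms(8) rv(1,3)] term_int[OF assms(9) rv(2,4)]
      by (simp_all add: Bochner_Integration.integral_sum)
    have ab0: "0 \<le> a i" "0 \<le> b i" if "i \<in> {1..p}" for i
      unfolding a_def b_def using nonneg[OF that] by simp_all
    have energy: "a i + b i \<le> 2 * c i"
      "a i + b i = 2 * c i \<longleftrightarrow> distr M (Rn (d i)) (\<lambda>\<omega>. X \<omega> i) = distr M (Rn (d i)) (\<lambda>\<omega>. Y \<omega> i)"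
      "distr M (Rn (d i)) (\<lambda>\<omega>. X \<omega> i) = distr M (Rn (d i)) (\<lambda>\<omega>. Y \<omega> i) \<Longrightarrow> a i = b i"
      if i: "i \<in> {1..p}" for i
    proof -
      have snt: "strong_negative_type (Rn (d i)) (\<rho> i)"
        and m: "case_prod (\<rho> i) \<in> borel_measurable (Rn (d i) \<Otimes>\<^sub>M Rn (d i))"
        using S1 i by auto
      note e = strong_negative_type_energy[OF snt m compose[OF comp[OF i]], OF
          term_int[OF assms(7) rv(1,2) i] term_int[OF assms(8) rv(1,3) i] term_int[OF assms(9) rv(2,4) i]]
      show "a i + b i \<le> 2 * c i" unfolding a_def b_def c_def by (rule e(1))
      show "a i + b i = 2 * c i \<longleftrightarrow> distr M (Rn (d i)) (\<lambda>\<omega>. X \<omega> i) = distr M (Rn (d i)) (\<lambda>\<omega>. Y \<omega> i)"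
        unfolding a_def b_def c_def by (rule e(2))
      show "distr M (Rn (d i)) (\<lambda>\<omega>. X \<omega> i) = distr M (Rn (d i)) (\<lambda>\<omega>. Y \<omega> i) \<Longrightarrow> a i = b i"
        unfolding a_def b_def c_def by (rule e(3))
    qed
    \<comment> \<open>The total gap is a sum of the energy distances of the groups. All are
      nonnegative, so the sum vanishes exactly when each of them does.\<close>
    have gap: "2 * (\<Sum>i=1..p. c i) - ((\<Sum>i=1..p. a i) + (\<Sum>i=1..p. b i))
        = (\<Sum>i=1..p. 2 * c i - (a i + b i))"
      by (simp add: sum_subtractf sum.distrib sum_distrib_left)
    have gap0: "0 \<le> (\<Sum>i=1..p. 2 * c i - (a i + b i))"
      using energy(1) by (intro sum_nonneg) simp
    have "(\<Sum>i=1..p. a i) + (\<Sum>i=1..p. b i) = 2 * (\<Sum>i=1..p. c i)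
        \<longleftrightarrow> (\<Sum>i=1..p. 2 * c i - (a i + b i)) = 0"
      unfolding gap[symmetric] by auto
    also have "\<dots> \<longleftrightarrow> (\<forall>i\<in>{1..p}. 2 * c i - (a i + b i) = 0)"
      using energy(1) by (intro sum_nonneg_eq_0_iff) auto
    also have "\<dots> \<longleftrightarrow> (\<forall>i\<in>{1..p}. distr M (Rn (d i)) (\<lambda>\<omega>. X \<omega> i) = distr M (Rn (d i)) (\<lambda>\<omega>. Y \<omega> i))"
    proof (intro ball_cong refl)
      fix i assume i: "i \<in> {1..p}"
      show "2 * c i - (a i + b i) = 0 \<longleftrightarrow>
          distr M (Rn (d i)) (\<lambda>\<omega>. X \<omega> i) = distr M (Rn (d i)) (\<lambda>\<omega>. Y \<omega> i)"
        unfolding energy(2)[OF i, symmetric] by auto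
    qed
    finally have eq_iff: "(\<Sum>i=1..p. a i) + (\<Sum>i=1..p. b i) = 2 * (\<Sum>i=1..p. c i) \<longleftrightarrow>
      (\<forall>i\<in>{1..p}. distr M (Rn (d i)) (\<lambda>\<omega>. X \<omega> i) = distr M (Rn (d i)) (\<lambda>\<omega>. Y \<omega> i))" .
    \<comment> \<open>Equal group laws also equate the within-sample sums, so the second condition
      of the square root lemma follows from the first.\<close>
    have ab: "(\<Sum>i=1..p. a i) = (\<Sum>i=1..p. b i)"
      if "\<forall>i\<in>{1..p}. distr M (Rn (d i)) (\<lambda>\<omega>. X \<omega> i) = distr M (Rn (d i)) (\<lambda>\<omega>. Y \<omega> i)"
    proof (rule sum.cong[OF refl])
      fix i assume i: "i \<in> {1..p}"
      show "a i = b i" by (rule energy(3)[OF i bspec[OF that i]])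
    qed
    have "2 * \<tau> - \<tau>\<^sub>X - \<tau>\<^sub>Y = 0 \<longleftrightarrow> (\<Sum>i=1..p. a i) + (\<Sum>i=1..p. b i) = 2 * (\<Sum>i=1..p. c i)
        \<and> (\<Sum>i=1..p. a i) = (\<Sum>i=1..p. b i)"
      unfolding t
    proof (rule double_sqrt_eq_sum_sqrt_iff)
      show "0 \<le> (\<Sum>i=1..p. a i)" "0 \<le> (\<Sum>i=1..p. b i)" by (intro sum_nonneg ab0; simp)+
      show "(\<Sum>i=1..p. a i) + (\<Sum>i=1..p. b i) \<le> 2 * (\<Sum>i=1..p. c i)"
        using gap gap0 by linarith
    qed
    also have "\<dots> \<longleftrightarrow> (\<forall>i\<in>{1..p}. distr M (Rn (d i)) (\<lambda>\<omega>. X \<omega> i) = distr M (Rn (d i)) (\<lambda>\<omega>. Y \<omega> i))"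
      unfolding eq_iff using ab by blast
    finally show "2 * \<tau> - \<tau>\<^sub>X - \<tau>\<^sub>Y = 0 \<longleftrightarrow>
      (\<forall>i\<in>{1..p}. distr M (Rn (d i)) (\<lambda>\<omega>. X \<omega> i) = distr M (Rn (d i)) (\<lambda>\<omega>. Y \<omega> i))" .
  next

    \<comment> \<open>Case S2: squared Euclidean distances, means and traces\<close>
    assume S2: "\<forall>i\<in>{1..p}. \<forall>x\<in>space (Rn (d i)). \<forall>y\<in>space (Rn (d i)).
      \<rho> i x y = (L2_set (\<lambda>j. x j - y j) {1..d i})\<^sup>2"
    \<comment> \<open>Pairs of group and position become a single index, so that the squared
      distance is one sum over real coordinates.\<close>
    define C where "C = coords p d"
    define x where "x = (\<lambda>k \<omega>. X \<omega> (fst k) (snd k))"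
    define y where "y = (\<lambda>k \<omega>. Y \<omega> (fst k) (snd k))"
    have finC: "finite C" by (simp add: C_def coords_def)
    have inC: "fst k \<in> {1..p}" "snd k \<in> {1..d (fst k)}" if "k \<in> C" for k
      using that by (auto simp: C_def coords_def)
    \<comment> \<open>The identity is confined to \<open>space M\<close>, where \<open>S2\<close>
      applies; integrals are therefore rewritten by congruence on that space.\<close>
    have K2: "(K_dist p \<rho> (U \<omega>) (V \<omega>))\<^sup>2
        = (\<Sum>k\<in>C. (U \<omega> (fst k) (snd k) - V \<omega> (fst k) (snd k))\<^sup>2)"
      if "U \<in> measurable M G" "V \<in> measurable M G" "\<omega> \<in> space M" for U V \<omega>
    proof -
      have "(\<Sum>i=1..p. \<rho> i (U \<omega> i) (V \<omega> i)) = (\<Sum>i=1..p. \<Sum>j=1..d i. (U \<omega> i j - V \<omega> i j)\<^sup>2)"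
      proof (intro sum.cong refl)
        fix i assume i: "i \<in> {1..p}"
        then have "\<rho> i (U \<omega> i) (V \<omega> i) = (L2_set (\<lambda>j. U \<omega> i j - V \<omega> i j) {1..d i})\<^sup>2"
          using S2 sp[OF that(1,3) i] sp[OF that(2,3) i] by blast
        then show "\<rho> i (U \<omega> i) (V \<omega> i) = (\<Sum>j=1..d i. (U \<omega> i j - V \<omega> i j)\<^sup>2)"
          by (simp add: L2_set_def sum_nonneg)
      qed
      also have "\<dots> = (\<Sum>k\<in>C. (U \<omega> (fst k) (snd k) - V \<omega> (fst k) (snd k))\<^sup>2)"
        unfolding C_def coords_def by (subst sum.Sigma) (auto simp: case_prod_beta)
      finally show ?thesis unfolding K_dist_def by (simp add: sum_nonneg)
    qed
    have term_int: "integrable M (\<lambda>\<omega>. (U \<omega> (fst k) (snd k) - V \<omega> (fst k) (snd k))\<^sup>2)"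
      if int: "integrable M (\<lambda>\<omega>. (K_dist p \<rho> (U \<omega>) (V \<omega>))\<^sup>2)"
        and UV: "U \<in> measurable M G" "V \<in> measurable M G" and k: "k \<in> C" for U V k
    proof (rule integrable_sum_nonneg[where f = "\<lambda>k \<omega>. (U \<omega> (fst k) (snd k) - V \<omega> (fst k) (snd k))\<^sup>2"])
      show "integrable M (\<lambda>\<omega>. \<Sum>k\<in>C. (U \<omega> (fst k) (snd k) - V \<omega> (fst k) (snd k))\<^sup>2)"
        using int by (subst (asm) Bochner_Integration.integrable_cong[OF refl K2[OF UV]]) auto
      have [measurable]: "(\<lambda>\<omega>. U \<omega> (fst k) (snd k)) \<in> borel_measurable M"
        "(\<lambda>\<omega>. V \<omega> (fst k) (snd k)) \<in> borel_measurable M"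
        using measurable_compose[OF UV(1) comp2[OF inC[OF k]]]
          measurable_compose[OF UV(2) comp2[OF inC[OF k]]] by auto
      show "(\<lambda>\<omega>. (U \<omega> (fst k) (snd k) - V \<omega> (fst k) (snd k))\<^sup>2) \<in> borel_measurable M"
        by measurable
    qed (use finC k in auto)
    have EK: "expectation (\<lambda>\<omega>. (K_dist p \<rho> (U \<omega>) (V \<omega>))\<^sup>2)
        = (\<Sum>k\<in>C. expectation (\<lambda>\<omega>. (U \<omega> (fst k) (snd k) - V \<omega> (fst k) (snd k))\<^sup>2))"
      if int: "integrable M (\<lambda>\<omega>. (K_dist p \<rho> (U \<omega>) (V \<omega>))\<^sup>2)"
        and UV: "U \<in> measurable M G" "V \<in> measurable M G" for U V
      by (subst Bochner_Integration.integral_cong[OF refl K2[OF UV]])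
        (auto intro!: Bochner_Integration.integral_sum term_int[OF int UV])
    have sq: "expectation (\<lambda>\<omega>. (X \<omega> (fst k) (snd k) - Y \<omega> (fst k) (snd k))\<^sup>2)
        = (expectation (x k) - expectation (y k))\<^sup>2 + variance (x k) + variance (y k)"
      "expectation (\<lambda>\<omega>. (X \<omega> (fst k) (snd k) - X' \<omega> (fst k) (snd k))\<^sup>2) = 2 * variance (x k)"
      "expectation (\<lambda>\<omega>. (Y \<omega> (fst k) (snd k) - Y' \<omega> (fst k) (snd k))\<^sup>2) = 2 * variance (y k)"
      if k: "k \<in> C" for k
      unfolding x_def y_def
      by (rule indep_copy_diff_square[OF compose[OF comp2[OF inC[OF k]]],
          OF term_int[OF assms(8) rv(1,3) k] term_int[OF assms(9) rv(2,4) k]])+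
    \<comment> \<open>For \<open>k\<close> in \<open>C\<close> the entry of \<open>mean_vec\<close>
      is the plain expectation, so the diagonal covariance entries are the coordinate
      variances.\<close>
    have tr: "trace_on C (cov_mat M p d W) = (\<Sum>k\<in>C. variance (\<lambda>\<omega>. W \<omega> (fst k) (snd k)))" for W
      unfolding trace_on_def
    proof (intro sum.cong refl)
      fix k assume "k \<in> C"
      then show "cov_mat M p d W k k = variance (\<lambda>\<omega>. W \<omega> (fst k) (snd k))"
        using inC[of k] by (cases k) (simp add: cov_mat_def mean_vec_def power2_eq_square)
    qed
    define tX where "tX = trace_on C (cov_mat M p d X)"
    define tY where "tY = trace_on C (cov_mat M p d Y)"
    define D where "D = (\<Sum>k\<in>C. (expectation (x k) - expectation (y k))\<^sup>2)"
    have "(\<Sum>k\<in>C. expectation (\<lambda>\<omega>. (X \<omega> (fst k) (snd k) - Y \<omega> (fst k) (snd k))\<^sup>2)) = D + tX + tY"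
      unfolding D_def tX_def tY_def tr sum.distrib[symmetric] x_def y_def
      by (intro sum.cong refl sq(1)[unfolded x_def y_def])
    then have t: "\<tau> = sqrt (D + tX + tY)"
      unfolding assms(10) rms_dist_def EK[OF assms(7) rv(1,2)] by simp
    have "(\<Sum>k\<in>C. expectation (\<lambda>\<omega>. (X \<omega> (fst k) (snd k) - X' \<omega> (fst k) (snd k))\<^sup>2)) = 2 * tX"
      unfolding tX_def tr sum_distrib_left by (intro sum.cong refl sq(2)[unfolded x_def])
    then have tX: "\<tau>\<^sub>X = sqrt (2 * tX)"
      unfolding assms(11) rms_dist_def EK[OF assms(8) rv(1,3)] by simp
    have "(\<Sum>k\<in>C. expectation (\<lambda>\<omega>. (Y \<omega> (fst k) (snd k) - Y' \<omega> (fst k) (snd k))\<^sup>2)) = 2 * tY"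
      unfolding tY_def tr sum_distrib_left by (intro sum.cong refl sq(3)[unfolded y_def])
    then have tY: "\<tau>\<^sub>Y = sqrt (2 * tY)"
      unfolding assms(12) rms_dist_def EK[OF assms(9) rv(2,4)] by simp
    have nn: "0 \<le> D" "0 \<le> tX" "0 \<le> tY"
      unfolding D_def tX_def tY_def tr by (auto intro!: sum_nonneg)
    have "D = 0 \<longleftrightarrow> (\<forall>k\<in>C. expectation (x k) = expectation (y k))"
      unfolding D_def using finC by (subst sum_nonneg_eq_0_iff) auto
    also have "\<dots> \<longleftrightarrow> (\<forall>i\<in>{1..p}. \<forall>j\<in>{1..d i}. expectation (\<lambda>\<omega>. X \<omega> i j) = expectation (\<lambda>\<omega>. Y \<omega> i j))"
      by (auto simp: C_def coords_def x_def y_def)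
    \<comment> \<open>\<open>mean_vec\<close> is restricted to its index range and constant outside,
      so equality of functions amounts to equality of the entries in range.\<close>
    also have "\<dots> \<longleftrightarrow> mean_vec M p d X = mean_vec M p d Y"
      by (auto simp: mean_vec_def fun_eq_iff restrict_def)
    finally have D0: "D = 0 \<longleftrightarrow> mean_vec M p d X = mean_vec M p d Y" .
    \<comment> \<open>The hypothesis of the square root lemma reduces to \<open>0 \<le> D\<close>,
      and its equality case to \<open>D = 0\<close>.\<close>
    have "2 * \<tau> - \<tau>\<^sub>X - \<tau>\<^sub>Y = 0 \<longleftrightarrow> 2 * tX + 2 * tY = 2 * (D + tX + tY) \<and> 2 * tX = 2 * tY"
      unfolding t tX tY using nn by (intro double_sqrt_eq_sum_sqrt_iff) auto
    also have "\<dots> \<longleftrightarrow> D = 0 \<and> tX = tY" by auto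
    finally show "2 * \<tau> - \<tau>\<^sub>X - \<tau>\<^sub>Y = 0 \<longleftrightarrow> mean_vec M p d X = mean_vec M p d Y \<and>
        trace_on (coords p d) (cov_mat M p d X) = trace_on (coords p d) (cov_mat M p d Y)"
      unfolding D0 tX_def tY_def C_def .
  qed
qed

end
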